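(* Let $n \geq 3$, let $p(z)=\sum_{j=0}^{n} a_j z^j$ be a real polynomial with positive coefficients $a_0,\dots,a_n>0$, let $0<\varepsilon\leq 1$, and define $$\gamma_2=\frac{(1-\varepsilon)a_{n-1}}{a_n},\quad \gamma_1=\frac{a_{n-2}-\gamma_2 a_{n-1}}{a_n},$$ $$\gamma_0=\max\left\{0,\ \frac{\gamma_1 a_0}{-a_1},\ \frac{\gamma_2 a_0+\gamma_1 a_1}{-a_2},\ \max_{0\leq j\leq n-3}\frac{a_j-\gamma_2 a_{j+1}-\gamma_1 a_{j+2}}{a_{j+3}}\right\},$$ and $$\delta_2=\frac{(1-\varepsilon)a_1}{a_0},\quad \delta_1=\frac{a_2-\delta_2 a_1}{a_0},$$ $$\delta_0=\max\left\{0,\ \frac{\delta_1 a_n}{-a_{n-1}},\ \frac{\delta_2 a_n+\delta_1 a_{n-1}}{-a_{n-2}},\ \max_{0\leq j\leq n-3}\frac{a_{j+3}-\delta_2 a_{j+2}-\delta_1 a_{j+1}}{a_j}\right\}.$$ Denote by $\mu_1$ the unique positive zero of $z^3-\gamma_2 z^2-\gamma_1 z-\gamma_0$ and by $1/\mu_2$ the unique positive zero of $z^3-\delta_2 z^2-\delta_1 z-\delta_0$. Then all the zeros of $p$ lie in the closed disk $D\!\left(\varepsilon\frac{a_{n-1}}{a_n},\mu_1\right)$, but are excluded from the open disk $\Delta\!\left(\frac{1}{\varepsilon}\frac{a_0}{a_1},\mu_2\right)$.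
   Context: Zeros are complex zeros. For a number $a$ and $\gamma>0$, define $$D(a,\gamma)=\{z\in\mathbb{C}:|z+a|\leq |a|+\gamma\},\qquad \Delta(a,\gamma)=\left\{z\in\mathbb{C}:\left|z-\frac{\gamma^2}{|a|+2\gamma}\right|<\frac{\gamma(|a|+\gamma)}{|a|+2\gamma}\right\}.$$ *)

theory Defs
  imports Complex_Main "HOL-Computational_Algebra.Polynomial"
begin

definition disk_D :: "complex \<Rightarrow> real \<Rightarrow> complex set" where
  "disk_D a \<gamma> = {z. norm (z + a) \<le> norm a + \<gamma>}"

definition disk_Delta :: "complex \<Rightarrow> real \<Rightarrow> complex set" where
  "disk_Delta a \<gamma> =
     {z. norm (z - of_real (\<gamma>^2 / (norm a + 2 * \<gamma>))) < \<gamma> * (norm a + \<gamma>) / (norm a + 2 * \<gamma>)}"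

text \<open>In what follows \<open>a\<close> is the coefficient sequence of a polynomial of degree \<open>n\<close>, of which
  only \<open>a 0, \<dots>, a n\<close> are used.\<close>

definition gamma2 :: "(nat \<Rightarrow> real) \<Rightarrow> nat \<Rightarrow> real \<Rightarrow> real" where
  "gamma2 a n \<epsilon> = (1 - \<epsilon>) * a (n - 1) / a n"

definition gamma1 :: "(nat \<Rightarrow> real) \<Rightarrow> nat \<Rightarrow> real \<Rightarrow> real" where
  "gamma1 a n \<epsilon> = (a (n - 2) - gamma2 a n \<epsilon> * a (n - 1)) / a n"

definition gamma0 :: "(nat \<Rightarrow> real) \<Rightarrow> nat \<Rightarrow> real \<Rightarrow> real" where
  "gamma0 a n \<epsilon> = Max {0,
      gamma1 a n \<epsilon> * a 0 / (- a 1),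
      (gamma2 a n \<epsilon> * a 0 + gamma1 a n \<epsilon> * a 1) / (- a 2),
      (MAX j\<in>{0..n - 3}. (a j - gamma2 a n \<epsilon> * a (j + 1) - gamma1 a n \<epsilon> * a (j + 2)) / a (j + 3))}"

definition delta2 :: "(nat \<Rightarrow> real) \<Rightarrow> real \<Rightarrow> real" where
  "delta2 a \<epsilon> = (1 - \<epsilon>) * a 1 / a 0"

definition delta1 :: "(nat \<Rightarrow> real) \<Rightarrow> real \<Rightarrow> real" where
  "delta1 a \<epsilon> = (a 2 - delta2 a \<epsilon> * a 1) / a 0"

definition delta0 :: "(nat \<Rightarrow> real) \<Rightarrow> nat \<Rightarrow> real \<Rightarrow> real" where
  "delta0 a n \<epsilon> = Max {0,
      delta1 a \<epsilon> * a n / (- a (n - 1)),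
      (delta2 a \<epsilon> * a n + delta1 a \<epsilon> * a (n - 1)) / (- a (n - 2)),
      (MAX j\<in>{0..n - 3}. (a (j + 3) - delta2 a \<epsilon> * a (j + 2) - delta1 a \<epsilon> * a (j + 1)) / a j)}"

definition is_pos_zero :: "real \<Rightarrow> real \<Rightarrow> real \<Rightarrow> real \<Rightarrow> bool" where
  "is_pos_zero c2 c1 c0 x \<longleftrightarrow> 0 < x \<and> x^3 - c2 * x^2 - c1 * x - c0 = 0"

text \<open>The two descriptions below are meaningful only when the positive zero exists and is unique;
  for positive coefficients and \<open>0 < \<epsilon> \<le> 1\<close> this is part of the claim of the theorem.\<close>

definition mu1 :: "(nat \<Rightarrow> real) \<Rightarrow> nat \<Rightarrow> real \<Rightarrow> real" where
  "mu1 a n \<epsilon> = (THE x. is_pos_zero (gamma2 a n \<epsilon>) (gamma1 a n \<epsilon>) (gamma0 a n \<epsilon>) x)"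

definition mu2 :: "(nat \<Rightarrow> real) \<Rightarrow> nat \<Rightarrow> real \<Rightarrow> real" where
  "mu2 a n \<epsilon> = 1 / (THE x. is_pos_zero (delta2 a \<epsilon>) (delta1 a \<epsilon>) (delta0 a n \<epsilon>) x)"

end

theory Submission
  imports Defs
begin

text \<open>
  Multiply \<open>p\<close> by the real cubic \<open>q = z\<^sup>3 - \<gamma>\<^sub>2 z\<^sup>2 - \<gamma>\<^sub>1 z - \<gamma>\<^sub>0\<close>. The first two \<open>\<gamma>\<close>'s are chosen so
  that the top coefficients of \<open>q p\<close> are \<open>a\<^sub>n\<close>, \<open>\<epsilon> a\<^sub>n\<^sub>-\<^sub>1\<close> and \<open>0\<close>; the number \<open>\<gamma>\<^sub>0\<close> is the least
  nonnegative one that makes all lower coefficients nonpositive. So \<open>q p\<close> has the sign pattern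
  \<open>+ + - \<dots> -\<close>, with zeros allowed among the last signs, which gives two things at once.

  First, a real polynomial with this pattern has at most one positive zero (one sign change).
  The zeros of \<open>q\<close> are among those of \<open>q p\<close>, so \<open>q\<close> has at most one positive zero; this matters because \<open>\<gamma>\<^sub>1\<close> may be negative and the signs of \<open>q\<close> alone do not
  decide it. Existence follows from the intermediate value theorem.

  Second, at a complex zero \<open>z\<close> of \<open>q p\<close> the two leading terms balance the remaining ones. If
  \<open>\<bar>z\<bar> \<ge> \<mu>\<close>, then, after division by the power \<open>z\<^sup>n\<^sup>+\<^sup>2\<close>, the remaining ones are at most as large as
  at the positive zero \<open>\<mu>\<close>, where there is equality; hence
  \<open>\<bar>z + \<epsilon> a\<^sub>n\<^sub>-\<^sub>1 / a\<^sub>n\<bar> \<le> \<mu> + \<epsilon> a\<^sub>n\<^sub>-\<^sub>1 / a\<^sub>n\<close>. If \<open>\<bar>z\<bar> < \<mu>\<close> the same bound is the triangle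
  inequality.

  The \<open>\<delta>\<close>'s are the \<open>\<gamma>\<close>'s of the reversed coefficient sequence, whose polynomial has the zeros
  \<open>1/z\<close>. Apart from the origin, the inner disk is the preimage under \<open>z \<mapsto> 1/z\<close> of the exterior of the
  outer disk of the reversed polynomial.
\<close>

section \<open>Polynomials with sign pattern + + - ... -\<close>

text \<open>Divided by \<open>x\<^sup>N y\<^sup>N\<close>, this says that \<open>\<Sum> c\<^sub>k x\<^sup>k\<^sup>-\<^sup>N\<close> decreases in \<open>x\<close>: all exponents are negative.\<close>

lemma lower_terms_scaled_le:
  fixes c :: "nat \<Rightarrow> real"
  assumes "\<And>k. k < N \<Longrightarrow> 0 \<le> c k" and "0 < x" and "x \<le> y"
  shows "x ^ N * (\<Sum>k<N. c k * y ^ k) \<le> y ^ N * (\<Sum>k<N. c k * x ^ k)"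
proof -
  have "x ^ N * (c k * y ^ k) \<le> y ^ N * (c k * x ^ k)" if k: "k < N" for k
  proof -
    have "x ^ (N - k) \<le> y ^ (N - k)"
      using assms by (intro power_mono) auto
    then have "(c k * x ^ k * y ^ k) * x ^ (N - k) \<le> (c k * x ^ k * y ^ k) * y ^ (N - k)"
      using assms k by (intro mult_left_mono) auto
    moreover have "x ^ N = x ^ k * x ^ (N - k)" "y ^ N = y ^ k * y ^ (N - k)"
      using k by (simp_all flip: power_add)
    ultimately show ?thesis
      by (simp add: mult_ac)
  qed
  then show ?thesis
    unfolding sum_distrib_left by (intro sum_mono) auto
qed

text \<open>Divide the equation for a zero by \<open>x\<^sup>N\<close>: the left side becomes \<open>A (x + \<alpha>)\<close> and increases strictly,
  the right side decreases. This is the case of Descartes' rule of signs that the cubic requires.\<close>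

lemma one_sign_change_zero_unique:
  fixes c :: "nat \<Rightarrow> real"
  assumes c: "\<And>k. k < N \<Longrightarrow> 0 \<le> c k" and "0 < A" and "0 < x" and "0 < y"
    and zx: "A * x ^ N * (x + \<alpha>) = (\<Sum>k<N. c k * x ^ k)"
    and zy: "A * y ^ N * (y + \<alpha>) = (\<Sum>k<N. c k * y ^ k)"
  shows "x = y"
proof -
  have "v \<le> u"
    if "0 < u" "u \<le> v"
      and zu: "A * u ^ N * (u + \<alpha>) = (\<Sum>k<N. c k * u ^ k)"
      and zv: "A * v ^ N * (v + \<alpha>) = (\<Sum>k<N. c k * v ^ k)" for u v
  proof -
    have "u ^ N * (A * v ^ N * (v + \<alpha>)) \<le> v ^ N * (A * u ^ N * (u + \<alpha>))"
      using lower_terms_scaled_le[of N c u v] c that by simp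
    then have "(A * u ^ N * v ^ N) * (v + \<alpha>) \<le> (A * u ^ N * v ^ N) * (u + \<alpha>)"
      by (simp add: mult_ac)
    then show ?thesis
      using that \<open>0 < A\<close> by (simp add: mult_le_cancel_left_pos)
  qed
  from this[of x y] this[of y x] show ?thesis
    using assms by linarith
qed

text \<open>For \<open>\<bar>z\<bar> \<ge> \<mu>\<close> the same monotonicity bounds \<open>A \<bar>z + \<alpha>\<bar> \<le> \<Sum> c\<^sub>k \<bar>z\<bar>\<^sup>k\<^sup>-\<^sup>N\<close> by its value \<open>A (\<mu> + \<alpha>)\<close> at the
  positive zero. Keeping the two leading terms together is what gives a disk with centre
  \<open>-\<alpha>\<close>, and not only one with centre \<open>0\<close>.\<close>

lemma one_sign_change_zeros_in_disk:
  fixes c :: "nat \<Rightarrow> real" and z :: complex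
  assumes c: "\<And>k. k < N \<Longrightarrow> 0 \<le> c k" and "0 < A" and "0 \<le> \<alpha>" and "0 < \<mu>"
    and zero_mu: "A * \<mu> ^ N * (\<mu> + \<alpha>) = (\<Sum>k<N. c k * \<mu> ^ k)"
    and zero_z: "of_real A * z ^ N * (z + of_real \<alpha>) = (\<Sum>k<N. of_real (c k) * z ^ k)"
  shows "norm (z + of_real \<alpha>) \<le> \<alpha> + \<mu>"
proof (cases "norm z \<le> \<mu>")
  case True
  then show ?thesis
    using norm_triangle_ineq[of z "of_real \<alpha>"] \<open>0 \<le> \<alpha>\<close> by simp
next
  case False
  define r where "r = norm z"
  have r: "\<mu> \<le> r" "0 < r" using False \<open>0 < \<mu>\<close> by (auto simp: r_def)
  have "A * r ^ N * norm (z + of_real \<alpha>) = norm (\<Sum>k<N. of_real (c k) * z ^ k)"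
    using \<open>0 < A\<close> by (simp flip: zero_z add: norm_mult norm_power r_def)
  also have "\<dots> \<le> (\<Sum>k<N. c k * r ^ k)"
    by (rule sum_norm_le) (simp add: norm_mult norm_power c r_def)
  finally have "\<mu> ^ N * (A * r ^ N * norm (z + of_real \<alpha>)) \<le> \<mu> ^ N * (\<Sum>k<N. c k * r ^ k)"
    using \<open>0 < \<mu>\<close> by (intro mult_left_mono) auto
  also have "\<dots> \<le> r ^ N * (A * \<mu> ^ N * (\<mu> + \<alpha>))"
    unfolding zero_mu using c \<open>0 < \<mu>\<close> r by (intro lower_terms_scaled_le)
  finally have "(A * \<mu> ^ N * r ^ N) * norm (z + of_real \<alpha>) \<le> (A * \<mu> ^ N * r ^ N) * (\<mu> + \<alpha>)"
    by (simp add: mult_ac)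
  then show ?thesis
    using \<open>0 < A\<close> \<open>0 < \<mu>\<close> r by (simp add: mult_le_cancel_left_pos add.commute)
qed

section \<open>The cubic multiplier\<close>

text \<open>Each entry of the maximum is the bound that makes one coefficient of the product
  nonpositive.\<close>

lemma gamma0_bounds:
  shows "0 \<le> gamma0 a n \<epsilon>"
    and "gamma1 a n \<epsilon> * a 0 / (- a 1) \<le> gamma0 a n \<epsilon>"
    and "(gamma2 a n \<epsilon> * a 0 + gamma1 a n \<epsilon> * a 1) / (- a 2) \<le> gamma0 a n \<epsilon>"
    and "j \<le> n - 3 \<Longrightarrow>
      (a j - gamma2 a n \<epsilon> * a (j + 1) - gamma1 a n \<epsilon> * a (j + 2)) / a (j + 3) \<le> gamma0 a n \<epsilon>"
proof -
  let ?f = "\<lambda>j. (a j - gamma2 a n \<epsilon> * a (j + 1) - gamma1 a n \<epsilon> * a (j + 2)) / a (j + 3)"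
  show "?f j \<le> gamma0 a n \<epsilon>" if "j \<le> n - 3"
  proof -
    have "?f j \<le> (MAX j\<in>{0..n - 3}. ?f j)"
      using that by (intro Max_ge) auto
    also have "\<dots> \<le> gamma0 a n \<epsilon>"
      unfolding gamma0_def by (intro Max_ge) auto
    finally show ?thesis .
  qed
qed (unfold gamma0_def, (intro Max_ge; simp)+)

text \<open>The polynomial has degree \<open>m + 3\<close>, so that the three coefficients at each end, where not all four
  terms of the convolution are present, never overlap with one another.\<close>

lemma sum_times_cubic:
  fixes A :: "nat \<Rightarrow> 'a :: comm_ring_1"
  shows "(\<Sum>j<m + 4. A j * z ^ j) * (z ^ 3 - g2 * z ^ 2 - g1 * z - g0)
    = - g0 * A 0 - (g1 * A 0 + g0 * A 1) * z - (g2 * A 0 + g1 * A 1 + g0 * A 2) * z ^ 2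
      + (\<Sum>j<m + 1. (A j - g2 * A (j + 1) - g1 * A (j + 2) - g0 * A (j + 3)) * z ^ (j + 3))
      + (A (m + 1) - g2 * A (m + 2) - g1 * A (m + 3)) * z ^ (m + 4)
      + (A (m + 2) - g2 * A (m + 3)) * z ^ (m + 5) + A (m + 3) * z ^ (m + 6)"
proof (induction m)
  case 0
  show ?case
    by (simp add: eval_nat_numeral algebra_simps)
next
  case (Suc m)
  have "(\<Sum>j<Suc m + 4. A j * z ^ j) = (\<Sum>j<m + 4. A j * z ^ j) + A (m + 4) * z ^ (m + 4)"
    by (simp add: eval_nat_numeral)
  then show ?case
    by (simp only: distrib_right Suc.IH) (simp add: eval_nat_numeral algebra_simps)
qed

text \<open>Up to sign, the coefficients of degree below \<open>n + 2\<close> of the product of the polynomial and the cubic.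
  The convolution is truncated for \<open>k \<le> 2\<close>. At \<open>k = n + 1\<close> the general formula would
  involve \<open>a (n + 1)\<close>, which is not a coefficient of the polynomial; without that term it gives \<open>0\<close> by
  the choice of \<^const>\<open>gamma1\<close>.\<close>

definition cubic_lower_coeff :: "(nat \<Rightarrow> real) \<Rightarrow> nat \<Rightarrow> real \<Rightarrow> nat \<Rightarrow> real" where
  "cubic_lower_coeff a n \<epsilon> k =
     (if k = 0 then gamma0 a n \<epsilon> * a 0
      else if k = 1 then gamma1 a n \<epsilon> * a 0 + gamma0 a n \<epsilon> * a 1
      else if k = 2 then gamma2 a n \<epsilon> * a 0 + gamma1 a n \<epsilon> * a 1 + gamma0 a n \<epsilon> * a 2
      else if k = n + 1 then 0
      else gamma0 a n \<epsilon> * a k + gamma1 a n \<epsilon> * a (k - 1) + gamma2 a n \<epsilon> * a (k - 2) - a (k - 3))"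

lemma cubic_lower_coeff_nonneg:
  assumes n: "n \<ge> 3" and pos: "\<And>j. j \<le> n \<Longrightarrow> a j > 0" and k: "k < n + 2"
  shows "0 \<le> cubic_lower_coeff a n \<epsilon> k"
proof -
  consider "k = 0" | "k = 1" | "k = 2" | "k = n + 1" | j where "k = j + 3" "j \<le> n - 3"
  proof (cases "k < 3 \<or> k = n + 1")
    case True
    then show ?thesis using that by (auto simp: numeral_3_eq_3 less_Suc_eq)
  next
    case False
    then show ?thesis using that(5)[of "k - 3"] k by auto
  qed
  then show ?thesis
  proof cases
    case 1
    then show ?thesis
      using gamma0_bounds(1)[where a = a and n = n and \<epsilon> = \<epsilon>] pos[of 0]
      by (simp add: cubic_lower_coeff_def)
  next
    case 2
    then show ?thesis
      using gamma0_bounds(2)[where a = a and n = n and \<epsilon> = \<epsilon>] pos[of 1] n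
      by (simp add: cubic_lower_coeff_def field_simps)
  next
    case 3
    then show ?thesis
      using gamma0_bounds(3)[where a = a and n = n and \<epsilon> = \<epsilon>] pos[of 2] n
      by (simp add: cubic_lower_coeff_def field_simps)
  next
    case 4
    then show ?thesis using n by (simp add: cubic_lower_coeff_def)
  next
    case (5 j)
    then show ?thesis
      using gamma0_bounds(4)[where a = a and n = n and \<epsilon> = \<epsilon> and j = j] pos[of "j + 3"] n
      by (simp add: cubic_lower_coeff_def field_simps numeral_3_eq_3 numeral_2_eq_2)
  qed
qed

text \<open>The choice of \<^const>\<open>gamma2\<close> turns the coefficient of degree \<open>n + 2\<close> into
  \<open>\<epsilon> a\<^sub>n\<^sub>-\<^sub>1\<close>, and that of \<^const>\<open>gamma1\<close> annihilates the one of degree \<open>n + 1\<close>. The identity is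
  needed over the reals for the zeros of the cubic and over the complex numbers for those of the
  polynomial.\<close>

lemma polynomial_times_gamma_cubic:
  fixes z :: "'a :: {real_algebra_1, comm_ring_1}"
  assumes n: "n \<ge> 3" and an: "a n > 0"
  shows "(\<Sum>j=0..n. of_real (a j) * z ^ j)
        * (z ^ 3 - of_real (gamma2 a n \<epsilon>) * z ^ 2 - of_real (gamma1 a n \<epsilon>) * z - of_real (gamma0 a n \<epsilon>))
      = of_real (a n) * z ^ (n + 2) * (z + of_real (\<epsilon> * (a (n - 1) / a n)))
        - (\<Sum>k<n + 2. of_real (cubic_lower_coeff a n \<epsilon> k) * z ^ k)"
proof -
  define m where "m = n - 3"
  have nm: "n = m + 3" using n by (simp add: m_def)
  then have nm5: "n + 2 = m + 5" by simp
  define \<alpha> where "\<alpha> = \<epsilon> * (a (n - 1) / a n)"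
  define g2 g1 g0 where g: "g2 = gamma2 a n \<epsilon>" "g1 = gamma1 a n \<epsilon>" "g0 = gamma0 a n \<epsilon>"
  have top: "g2 * a n = (1 - \<epsilon>) * a (n - 1)" "g1 * a n = a (n - 2) - g2 * a (n - 1)"
    using an by (simp_all add: g gamma1_def gamma2_def)
  let ?A = "\<lambda>j. of_real (a j) :: 'a" and ?c = "\<lambda>k. of_real (cubic_lower_coeff a n \<epsilon> k) :: 'a"
  have "(\<Sum>k<n + 2. ?c k * z ^ k)
      = ?c 0 + ?c 1 * z + ?c 2 * z ^ 2 + (\<Sum>j<m + 1. ?c (j + 3) * z ^ (j + 3)) + ?c (m + 4) * z ^ (m + 4)"
  proof -
    have "(\<Sum>k<m' + 5. f k) = f 0 + f 1 + f 2 + (\<Sum>j<m' + 1. f (j + 3)) + f (m' + 4)"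
      for m' and f :: "nat \<Rightarrow> 'a"
      by (induction m') (simp_all add: eval_nat_numeral)
    from this[of "\<lambda>k. ?c k * z ^ k" m] show ?thesis
      unfolding nm5 by simp
  qed
  also have "?c (m + 4) = 0"
    by (simp add: cubic_lower_coeff_def nm)
  also have "(\<Sum>j<m + 1. ?c (j + 3) * z ^ (j + 3))
      = - (\<Sum>j<m + 1. (?A j - of_real g2 * ?A (j + 1) - of_real g1 * ?A (j + 2) - of_real g0 * ?A (j + 3))
             * z ^ (j + 3))"
    unfolding sum_negf[symmetric]
    by (intro sum.cong) (auto simp: cubic_lower_coeff_def g nm eval_nat_numeral algebra_simps)
  finally have low: "(\<Sum>k<n + 2. ?c k * z ^ k) = ?c 0 + ?c 1 * z + ?c 2 * z ^ 2
      + - (\<Sum>j<m + 1. (?A j - of_real g2 * ?A (j + 1) - of_real g1 * ?A (j + 2) - of_real g0 * ?A (j + 3))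
             * z ^ (j + 3)) + 0 * z ^ (m + 4)" .
  have up: "?A (m + 1) - of_real g2 * ?A (m + 2) - of_real g1 * ?A (m + 3) = 0"
    "?A (m + 2) - of_real g2 * ?A (m + 3) = ?A n * of_real \<alpha>"
    using top an
    by (simp_all add: nm \<alpha>_def algebra_simps eval_nat_numeral flip: of_real_mult of_real_add of_real_diff)
  have set: "{0..n} = {..<m + 4}" by (auto simp: nm)
  show ?thesis
    unfolding set low g[symmetric] \<alpha>_def[symmetric] sum_times_cubic up
    by (simp add: cubic_lower_coeff_def g nm algebra_simps eval_nat_numeral)
qed

section \<open>The positive zero of the cubic and the outer disk\<close>

text \<open>The hypotheses say that the first of \<open>c0\<close>, \<open>c1\<close>, \<open>c2\<close> that does not vanish exists and is positive,
  so that the cubic is negative just to the right of \<open>0\<close>. After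
  division by the power of \<open>x\<close> that it contains, the intermediate value theorem applies from \<open>0\<close>
  itself.\<close>

lemma cubic_pos_zero_exists:
  assumes "0 \<le> c0" and "c0 = 0 \<Longrightarrow> 0 \<le> c1" and "c0 = 0 \<Longrightarrow> c1 = 0 \<Longrightarrow> 0 < c2"
  shows "\<exists>x. is_pos_zero c2 c1 c0 x"
proof -
  \<comment> \<open>the usual bound on all zeros, at least \<open>1\<close> so that \<open>X\<^sup>2\<close> dominates the lower powers\<close>
  define X where "X = 1 + \<bar>c2\<bar> + \<bar>c1\<bar> + \<bar>c0\<bar>"
  have X: "1 \<le> X" by (simp add: X_def)
  have fX: "0 \<le> X ^ 3 - c2 * X\<^sup>2 - c1 * X - c0"
  proof -
    have "c1 * X \<le> \<bar>c1\<bar> * X\<^sup>2" "c0 \<le> \<bar>c0\<bar> * X\<^sup>2"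
      using X mult_mono[of c1 "\<bar>c1\<bar>" X "X\<^sup>2"] mult_mono[of c0 "\<bar>c0\<bar>" 1 "X\<^sup>2"]
      by (simp_all add: self_le_power)
    moreover have "c2 * X\<^sup>2 \<le> \<bar>c2\<bar> * X\<^sup>2"
      by (intro mult_right_mono) auto
    moreover have "X ^ 3 = X\<^sup>2 + \<bar>c2\<bar> * X\<^sup>2 + \<bar>c1\<bar> * X\<^sup>2 + \<bar>c0\<bar> * X\<^sup>2"
    proof -
      have "X ^ 3 = X * X\<^sup>2" by (simp add: eval_nat_numeral)
      also have "\<dots> = (1 + \<bar>c2\<bar> + \<bar>c1\<bar> + \<bar>c0\<bar>) * X\<^sup>2" by (simp add: X_def)
      finally show ?thesis by (simp add: algebra_simps)
    qed
    ultimately show ?thesis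
      using zero_le_power2[of X] by linarith
  qed
  have IVT_zero: "\<exists>x. 0 < x \<and> f x = 0"
    if "f 0 < 0" "0 \<le> f X" "continuous_on {0..X} f" for f :: "real \<Rightarrow> real"
    using IVT'[of f 0 0 X] that X by (metis less_eq_real_def less_irrefl order_trans zero_le_one)
  consider "0 < c0" | "c0 = 0" "0 < c1" | "c0 = 0" "c1 = 0" "0 < c2"
    using assms by linarith
  then show ?thesis
  proof cases
    case 1
    with fX show ?thesis
      unfolding is_pos_zero_def
      by (intro IVT_zero) (auto intro!: continuous_intros)
  next
    case 2
    have "0 \<le> X * (X\<^sup>2 - c2 * X - c1)"
      using fX 2 by (simp add: algebra_simps eval_nat_numeral)
    then have "0 \<le> X\<^sup>2 - c2 * X - c1"
      using X by (simp add: zero_le_mult_iff)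
    then obtain x where "0 < x" "x\<^sup>2 - c2 * x - c1 = 0"
    proof -
      have "\<exists>x>0. x\<^sup>2 - c2 * x - c1 = 0"
        using \<open>0 \<le> X\<^sup>2 - c2 * X - c1\<close> 2 by (intro IVT_zero) (auto intro!: continuous_intros)
      then show ?thesis using that by blast
    qed
    moreover have "x ^ 3 - c2 * x\<^sup>2 - c1 * x = x * (x\<^sup>2 - c2 * x - c1)"
      by (simp add: algebra_simps eval_nat_numeral)
    ultimately show ?thesis
      using 2 by (auto simp: is_pos_zero_def)
  next
    case 3
    then show ?thesis
      by (intro exI[of _ c2]) (simp add: is_pos_zero_def eval_nat_numeral)
  qed
qed

lemma gamma_cubic_zero_balance:
  assumes "n \<ge> 3" and "\<And>j. j \<le> n \<Longrightarrow> a j > 0"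
    and "is_pos_zero (gamma2 a n \<epsilon>) (gamma1 a n \<epsilon>) (gamma0 a n \<epsilon>) x"
  shows "a n * x ^ (n + 2) * (x + \<epsilon> * (a (n - 1) / a n)) = (\<Sum>k<n + 2. cubic_lower_coeff a n \<epsilon> k * x ^ k)"
  using polynomial_times_gamma_cubic[of n a x \<epsilon>] assms by (simp add: is_pos_zero_def)

text \<open>For existence, a negative \<open>\<gamma>\<^sub>1\<close> is harmless because it makes \<open>\<gamma>\<^sub>0\<close> positive, and the degenerate
  cubic \<open>x\<^sup>3\<close> cannot occur because \<open>\<gamma>\<^sub>2 = 0\<close> forces \<open>\<gamma>\<^sub>1 = a\<^sub>n\<^sub>-\<^sub>2 / a\<^sub>n > 0\<close>. Uniqueness is inherited from the product with the polynomial.\<close>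

lemma gamma_cubic_unique_pos_zero:
  assumes n: "n \<ge> 3" and pos: "\<And>j. j \<le> n \<Longrightarrow> a j > 0" and \<epsilon>: "0 < \<epsilon>" "\<epsilon> \<le> 1"
  shows "\<exists>!x. is_pos_zero (gamma2 a n \<epsilon>) (gamma1 a n \<epsilon>) (gamma0 a n \<epsilon>) x"
proof (rule ex_ex1I)
  have a: "a 0 > 0" "a 1 > 0" "a (n - 1) > 0" "a (n - 2) > 0" "a n > 0"
    using pos n by auto
  have "0 \<le> gamma2 a n \<epsilon>"
    using a \<epsilon> by (simp add: gamma2_def)
  show "\<exists>x. is_pos_zero (gamma2 a n \<epsilon>) (gamma1 a n \<epsilon>) (gamma0 a n \<epsilon>) x"
  proof (rule cubic_pos_zero_exists)
    show "0 \<le> gamma0 a n \<epsilon>" by (rule gamma0_bounds)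
    show "0 \<le> gamma1 a n \<epsilon>" if "gamma0 a n \<epsilon> = 0"
      using gamma0_bounds(2)[where a = a and n = n and \<epsilon> = \<epsilon>] that a
      by (simp add: field_simps zero_le_mult_iff)
    show "0 < gamma2 a n \<epsilon>" if "gamma1 a n \<epsilon> = 0"
    proof -
      have "gamma2 a n \<epsilon> \<noteq> 0"
        using that a by (auto simp: gamma1_def)
      then show ?thesis using \<open>0 \<le> gamma2 a n \<epsilon>\<close> by simp
    qed
  qed
next
  fix x y
  assume "is_pos_zero (gamma2 a n \<epsilon>) (gamma1 a n \<epsilon>) (gamma0 a n \<epsilon>) x"
    and "is_pos_zero (gamma2 a n \<epsilon>) (gamma1 a n \<epsilon>) (gamma0 a n \<epsilon>) y"
  moreover note balance = this[THEN gamma_cubic_zero_balance[OF n pos, rotated]]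
  ultimately show "x = y"
    using pos[of n] cubic_lower_coeff_nonneg[of n a, OF n pos]
    by (intro one_sign_change_zero_unique[OF _ _ _ _ balance]) (auto simp: is_pos_zero_def)
qed

lemma polynomial_zeros_in_gamma_disk:
  fixes z :: complex
  assumes n: "n \<ge> 3" and pos: "\<And>j. j \<le> n \<Longrightarrow> a j > 0" and "0 < \<epsilon>"
    and \<mu>: "is_pos_zero (gamma2 a n \<epsilon>) (gamma1 a n \<epsilon>) (gamma0 a n \<epsilon>) \<mu>"
    and z: "(\<Sum>j=0..n. of_real (a j) * z ^ j) = 0"
  shows "norm (z + of_real (\<epsilon> * (a (n - 1) / a n))) \<le> \<epsilon> * (a (n - 1) / a n) + \<mu>"
proof (rule one_sign_change_zeros_in_disk)
  show "0 \<le> cubic_lower_coeff a n \<epsilon> k" if "k < n + 2" for k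
    using cubic_lower_coeff_nonneg[OF n pos that] .
  show "0 \<le> \<epsilon> * (a (n - 1) / a n)" "0 < a n"
    using \<open>0 < \<epsilon>\<close> pos[of n] pos[of "n - 1"] by (auto intro!: mult_nonneg_nonneg divide_nonneg_pos)
  show "0 < \<mu>" using \<mu> by (simp add: is_pos_zero_def)
  show "a n * \<mu> ^ (n + 2) * (\<mu> + \<epsilon> * (a (n - 1) / a n))
      = (\<Sum>k<n + 2. cubic_lower_coeff a n \<epsilon> k * \<mu> ^ k)"
    using gamma_cubic_zero_balance[OF n pos \<mu>] .
  show "of_real (a n) * z ^ (n + 2) * (z + of_real (\<epsilon> * (a (n - 1) / a n)))
      = (\<Sum>k<n + 2. of_real (cubic_lower_coeff a n \<epsilon> k) * z ^ k)"
    using polynomial_times_gamma_cubic[of n a z \<epsilon>] n pos[of n] z by simp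
qed

section \<open>Reversal and the inner disk\<close>

lemma delta_eq_gamma_reversed:
  assumes n: "n \<ge> 3"
  shows "delta2 a \<epsilon> = gamma2 (\<lambda>j. a (n - j)) n \<epsilon>"
    and "delta1 a \<epsilon> = gamma1 (\<lambda>j. a (n - j)) n \<epsilon>"
    and "delta0 a n \<epsilon> = gamma0 (\<lambda>j. a (n - j)) n \<epsilon>"
proof -
  show d2: "delta2 a \<epsilon> = gamma2 (\<lambda>j. a (n - j)) n \<epsilon>"
    using n by (simp add: delta2_def gamma2_def)
  show d1: "delta1 a \<epsilon> = gamma1 (\<lambda>j. a (n - j)) n \<epsilon>"
    using n by (simp add: delta1_def gamma1_def flip: d2)
  let ?f = "\<lambda>j. (a (j + 3) - delta2 a \<epsilon> * a (j + 2) - delta1 a \<epsilon> * a (j + 1)) / a j"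
  let ?g = "\<lambda>j. (a (n - j) - delta2 a \<epsilon> * a (n - (j + 1)) - delta1 a \<epsilon> * a (n - (j + 2))) / a (n - (j + 3))"
  have "?g j = ?f (n - 3 - j)" if "j \<le> n - 3" for j
  proof -
    have "n - 3 - j + 3 = n - j" "n - 3 - j + 2 = n - (j + 1)" "n - 3 - j + 1 = n - (j + 2)"
      "n - 3 - j = n - (j + 3)"
      using n that by auto
    then show ?thesis by metis
  qed
  then have "?g ` {0..n - 3} = (\<lambda>j. ?f (n - 3 - j)) ` {0..n - 3}"
    by (intro image_cong) auto
  also have "\<dots> = ?f ` (\<lambda>j. n - 3 - j) ` {0..n - 3}"
    by (simp only: image_image)
  also have "(\<lambda>j. n - 3 - j) ` {0..n - 3} = {0..n - 3}"
    by (rule bij_betw_imp_surj_on, rule bij_betw_byWitness[where f' = "\<lambda>j. n - 3 - j"]) auto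
  finally show "delta0 a n \<epsilon> = gamma0 (\<lambda>j. a (n - j)) n \<epsilon>"
    by (simp add: delta0_def gamma0_def flip: d1 d2)
qed

lemma reversed_sum_at_inverse_zero:
  fixes z :: "'a :: {real_algebra_1, field}"
  assumes "z \<noteq> 0" and "(\<Sum>j=0..n. of_real (a j) * z ^ j) = 0"
  shows "(\<Sum>j=0..n. of_real (a (n - j)) * (1 / z) ^ j) = 0"
proof -
  have "z ^ n * (\<Sum>j=0..n. of_real (a (n - j)) * (1 / z) ^ j)
      = (\<Sum>j=0..n. of_real (a (n - j)) * z ^ (n - j))"
    unfolding sum_distrib_left
    using \<open>z \<noteq> 0\<close> by (intro sum.cong) (auto simp: field_simps power_diff)
  also have "\<dots> = (\<Sum>j=0..n. of_real (a j) * z ^ j)"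
    by (rule sum.reindex_bij_witness[of _ "\<lambda>j. n - j" "\<lambda>j. n - j"]) auto
  finally show ?thesis using assms by simp
qed

text \<open>The circle \<open>\<bar>w + 1/A\<bar> = 1/A + 1/\<mu>\<close> is, in terms of \<open>z = 1/w\<close>, the Apollonius circle
  \<open>\<mu> \<bar>z + A\<bar> = (A + \<mu>) \<bar>z\<bar>\<close>. Squaring it and completing the square gives its centre and radius; the origin,
  the image of \<open>w = \<infinity>\<close>, lies inside, so the exterior of the \<open>w\<close>-circle corresponds to the inside of
  the \<open>z\<close>-circle.\<close>

lemma disk_Delta_iff_inverse_outside:
  fixes z :: complex
  assumes "0 < A" and "0 < \<mu>" and "z \<noteq> 0"
  shows "z \<in> disk_Delta (of_real A) \<mu> \<longleftrightarrow> 1 / A + 1 / \<mu> < norm (1 / z + of_real (1 / A))"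
proof -
  have square: "u < v \<longleftrightarrow> u\<^sup>2 < v\<^sup>2" if "0 \<le> u" "0 \<le> v" for u v :: real
    using that by (simp add: power_mono_iff not_le[symmetric])
  define B where "B = A + 2 * \<mu>"
  have B: "B > 0" using assms by (simp add: B_def)
  have "1 / z + of_real (1 / A) = (z + of_real A) / (z * of_real A)"
    using assms by (simp add: field_simps)
  then have norm: "norm (1 / z + of_real (1 / A)) = norm (z + of_real A) / (norm z * A)"
    using assms by (simp only: norm_mult norm_divide norm_of_real)
  have "1 / A + 1 / \<mu> < norm (1 / z + of_real (1 / A))
      \<longleftrightarrow> (A + \<mu>) * norm z < \<mu> * norm (z + of_real A)"
  proof -
    have "1 / A + 1 / \<mu> = (A + \<mu>) * norm z / (A * \<mu> * norm z)"
      using assms by (simp add: field_simps)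
    moreover have "norm (z + of_real A) / (norm z * A) = \<mu> * norm (z + of_real A) / (A * \<mu> * norm z)"
      using assms by (simp add: field_simps)
    ultimately show ?thesis
      using mult_pos_pos[OF mult_pos_pos[OF assms(1,2)], of "norm z"] \<open>z \<noteq> 0\<close>
      by (simp only: norm divide_less_cancel) auto
  qed
  also have "\<dots> \<longleftrightarrow> (A + \<mu>)\<^sup>2 * (norm z)\<^sup>2 < \<mu>\<^sup>2 * (norm (z + of_real A))\<^sup>2"
    using assms by (subst square) (auto simp: power_mult_distrib)
  also have "\<dots> \<longleftrightarrow> B * (Re z ^ 2 + Im z ^ 2) < 2 * \<mu>\<^sup>2 * Re z + \<mu>\<^sup>2 * A"
  proof -
    have "\<mu>\<^sup>2 * (norm (z + of_real A))\<^sup>2 - (A + \<mu>)\<^sup>2 * (norm z)\<^sup>2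
        = A * (2 * \<mu>\<^sup>2 * Re z + \<mu>\<^sup>2 * A - B * (Re z ^ 2 + Im z ^ 2))"
      unfolding cmod_power2 B_def by (simp add: algebra_simps power2_eq_square)
    then show ?thesis using \<open>0 < A\<close> by (smt (verit) zero_less_mult_iff)
  qed
  also have "\<dots> \<longleftrightarrow> (norm (z - of_real (\<mu>\<^sup>2 / B)))\<^sup>2 < (\<mu> * (A + \<mu>) / B)\<^sup>2"
  proof -
    have "B * ((\<mu> * (A + \<mu>) / B)\<^sup>2 - (norm (z - of_real (\<mu>\<^sup>2 / B)))\<^sup>2)
        = 2 * \<mu>\<^sup>2 * Re z + \<mu>\<^sup>2 * A - B * (Re z ^ 2 + Im z ^ 2)"
    proof -
      have "(\<mu> * (A + \<mu>))\<^sup>2 - (\<mu>\<^sup>2)\<^sup>2 = \<mu>\<^sup>2 * A * B"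
        by (simp add: B_def algebra_simps power2_eq_square)
      then have "B * ((\<mu> * (A + \<mu>) / B)\<^sup>2 - (\<mu>\<^sup>2 / B)\<^sup>2) = \<mu>\<^sup>2 * A"
        using B unfolding power_divide by (simp add: power2_eq_square flip: diff_divide_distrib)
      moreover have "(norm (z - of_real (\<mu>\<^sup>2 / B)))\<^sup>2 = (Re z - \<mu>\<^sup>2 / B)\<^sup>2 + (Im z)\<^sup>2"
        unfolding cmod_power2 minus_complex.sel Re_complex_of_real Im_complex_of_real by simp
      moreover have "B * (Re z - \<mu>\<^sup>2 / B)\<^sup>2 = B * (Re z)\<^sup>2 - 2 * \<mu>\<^sup>2 * Re z + B * (\<mu>\<^sup>2 / B)\<^sup>2"
        using B by (simp add: power2_diff algebra_simps)
      ultimately show ?thesis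
        by (simp add: algebra_simps)
    qed
    then show ?thesis using B by (smt (verit) zero_less_mult_iff)
  qed
  also have "\<dots> \<longleftrightarrow> norm (z - of_real (\<mu>\<^sup>2 / B)) < \<mu> * (A + \<mu>) / B"
    using assms B by (subst square) auto
  finally show ?thesis
    using assms by (simp add: disk_Delta_def B_def)
qed

theorem theorem4p2:
  fixes p :: "real poly" and n :: nat and a :: "nat \<Rightarrow> real" and \<epsilon> :: real
  assumes "n \<ge> 3"
    and "p = (\<Sum>j=0..n. monom (a j) j)"
    and "\<And>j. j \<le> n \<Longrightarrow> a j > 0"
    and "0 < \<epsilon>" and "\<epsilon> \<le> 1"
  shows "(\<exists>!x. is_pos_zero (gamma2 a n \<epsilon>) (gamma1 a n \<epsilon>) (gamma0 a n \<epsilon>) x)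
    \<and> (\<exists>!x. is_pos_zero (delta2 a \<epsilon>) (delta1 a \<epsilon>) (delta0 a n \<epsilon>) x)
    \<and> (\<forall>z :: complex. poly (map_poly complex_of_real p) z = 0 \<longrightarrow>
          z \<in> disk_D (complex_of_real (\<epsilon> * (a (n - 1) / a n))) (mu1 a n \<epsilon>)
        \<and> z \<notin> disk_Delta (complex_of_real (1 / \<epsilon> * (a 0 / a 1))) (mu2 a n \<epsilon>))"
proof (intro conjI allI impI)
  note n = assms(1) and pos = assms(3) and \<epsilon> = assms(4,5)
  let ?b = "\<lambda>j. a (n - j)"
  have posb: "?b j > 0" if "j \<le> n" for j
    using pos by simp
  note delta = delta_eq_gamma_reversed[OF n, of a \<epsilon>]
  show gamma_ex1: "\<exists>!x. is_pos_zero (gamma2 a n \<epsilon>) (gamma1 a n \<epsilon>) (gamma0 a n \<epsilon>) x"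
    using gamma_cubic_unique_pos_zero[OF n pos \<epsilon>] .
  show delta_ex1: "\<exists>!x. is_pos_zero (delta2 a \<epsilon>) (delta1 a \<epsilon>) (delta0 a n \<epsilon>) x"
    unfolding delta using gamma_cubic_unique_pos_zero[OF n posb \<epsilon>] .
  fix z :: complex
  assume "poly (map_poly complex_of_real p) z = 0"
  moreover have "map_poly complex_of_real p = (\<Sum>j=0..n. monom (of_real (a j)) j)"
    unfolding assms(2) by (rule poly_eqI) (simp add: coeff_map_poly coeff_sum if_distrib)
  ultimately have z: "(\<Sum>j=0..n. of_real (a j) * z ^ j) = 0"
    by (simp add: poly_sum poly_monom)
  have mu1: "is_pos_zero (gamma2 a n \<epsilon>) (gamma1 a n \<epsilon>) (gamma0 a n \<epsilon>) (mu1 a n \<epsilon>)"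
    unfolding mu1_def by (rule theI'[OF gamma_ex1])
  show "z \<in> disk_D (complex_of_real (\<epsilon> * (a (n - 1) / a n))) (mu1 a n \<epsilon>)"
    using polynomial_zeros_in_gamma_disk[OF n pos \<epsilon>(1) mu1 z] \<epsilon> pos[of n] pos[of "n - 1"]
    unfolding disk_D_def mem_Collect_eq norm_of_real by simp
  define \<nu> where "\<nu> = (THE x. is_pos_zero (delta2 a \<epsilon>) (delta1 a \<epsilon>) (delta0 a n \<epsilon>) x)"
  have \<nu>: "is_pos_zero (delta2 a \<epsilon>) (delta1 a \<epsilon>) (delta0 a n \<epsilon>) \<nu>"
    unfolding \<nu>_def by (rule theI'[OF delta_ex1])
  have mu2: "mu2 a n \<epsilon> = 1 / \<nu>"
    by (simp add: mu2_def \<nu>_def)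
  have "z \<noteq> 0"
  proof
    assume "z = 0"
    then have "a 0 = 0"
      using z by (simp add: power_0_left sum.atLeast_Suc_atMost)
    then show False using pos[of 0] by simp
  qed
  have a: "a 0 > 0" "a 1 > 0" using pos n by auto
  have "norm (1 / z + of_real (\<epsilon> * (?b (n - 1) / ?b n))) \<le> \<epsilon> * (?b (n - 1) / ?b n) + \<nu>"
    using reversed_sum_at_inverse_zero[OF \<open>z \<noteq> 0\<close> z] \<nu>[unfolded delta]
    by (intro polynomial_zeros_in_gamma_disk[OF n posb \<epsilon>(1)])
  also have "\<epsilon> * (?b (n - 1) / ?b n) = 1 / (1 / \<epsilon> * (a 0 / a 1))"
    using n by simp
  finally show "z \<notin> disk_Delta (complex_of_real (1 / \<epsilon> * (a 0 / a 1))) (mu2 a n \<epsilon>)"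
    using \<nu> \<open>z \<noteq> 0\<close> a \<epsilon>
    by (subst disk_Delta_iff_inverse_outside) (auto simp: mu2 is_pos_zero_def)
qed

end
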